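(* There are functions $f,g:\mathbb{N}\to\mathbb{N}$ with $f(n)/n\to \frac{1}{12}$ and $g(n)/n\to 2$ as $n\to\infty$ such that, for every sufficiently large $n$, the hypercube $Q_n$ contains $f(n)$ pairwise completely independent spanning trees, each of diameter at most $g(n)$. (In short: there exist $(\frac1{12}+o(1))n$ completely independent spanning trees in $Q_n$, each with diameter $(2+o(1))n$.)
   Context: The hypercube $Q_n$ has vertex set $\{0,1\}^n$, two vertices being adjacent if they differ in exactly one coordinate. Two spanning trees of a graph $G$ are completely independent if they have no edge in common and, for every pair of vertices $u,v$ of $G$, the $u$–$v$ paths in the two trees have no vertex in common other than $u$ and $v$. A set of spanning trees is completely independent if its members are pairwise completely independent. The diameter of a tree is the maximum distance between two of its vertices within the tree. *)

theory Defs
  imports Complex_Main "Graph_Theory.Graph_Theory"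
begin

text \<open>
  Undirected graphs are represented, as in \<^theory>\<open>Graph_Theory.Digraph\<close>, by symmetric digraphs: an edge
  between u and v is the pair of arcs (u, v) and (v, u).
\<close>

definition hypercube :: "nat \<Rightarrow> bool list pair_pre_digraph" where
  "hypercube n = \<lparr> pverts = {x. length x = n},
     parcs = {(x, y). length x = n \<and> length y = n \<and> (\<exists>!i. i < n \<and> x ! i \<noteq> y ! i)} \<rparr>"

text \<open>
  The library predicates for forests and trees are about digraphs: they exclude directed cycles only,
  and they count the closed walk u, v, u as a cycle. They are therefore not applicable to
  symmetric digraphs. In a loop-free symmetric digraph without parallel arcs, the cycles of the
  underlying undirected graph are exactly the cycles with at least three arcs.
\<close>

definition undirected_tree :: "'a pair_pre_digraph \<Rightarrow> bool" where
  "undirected_tree T \<longleftrightarrow>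
     pair_graph T \<and> connected (with_proj T) \<and>
     \<not> (\<exists>p. pre_digraph.cycle (with_proj T) p \<and> 3 \<le> length p)"

definition undirected_spanning_tree :: "'a pair_pre_digraph \<Rightarrow> 'a pair_pre_digraph \<Rightarrow> bool" where
  "undirected_spanning_tree T G \<longleftrightarrow> undirected_tree T \<and> spanning (with_proj T) (with_proj G)"

text \<open>
  Intended for two spanning trees of one graph, where u-v paths are unique; disjointness of the symmetric arc relations amounts
  to having no undirected edge in common.
\<close>

definition completely_independent :: "'a pair_pre_digraph \<Rightarrow> 'a pair_pre_digraph \<Rightarrow> bool" where
  "completely_independent S T \<longleftrightarrow>
     parcs S \<inter> parcs T = {} \<and>
     (\<forall>u v p q. pre_digraph.apath (with_proj S) u p v \<longrightarrow> pre_digraph.apath (with_proj T) u q v \<longrightarrow>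
        set (pawalk_verts u p) \<inter> set (pawalk_verts u q) \<subseteq> {u, v})"

text \<open>
  The distance is the least cost of a walk with unit arc costs. The supremum is a maximum for finite
  nonempty graphs, and it is finite iff such a graph is connected.
\<close>

definition graph_diameter :: "'a pair_pre_digraph \<Rightarrow> ereal" where
  "graph_diameter G =
     (SUP u \<in> pverts G. SUP v \<in> pverts G. wf_digraph.\<mu> (with_proj G) (\<lambda>_. 1) u v)"

end

theory Submission
  imports Defs "HOL-Real_Asymp.Real_Asymp"
begin

text \<open>
  Colour the vertices so that each colour class induces a connected graph of small radius and every
  vertex can be attached to every other class without two attachments using the same edge. A
  breadth-first tree of class j, with all other vertices attached as leaves, is a spanning tree
  whose inner vertices lie in class j; such trees are completely independent.

  With \<open>q = 2 ^ r\<close> and \<open>n / 8 < q \<le> n / 4\<close>, take two disjoint blocks of coordinates, each with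
  two coordinates for every nonzero element of the group of r-bit numbers under xor. A further
  coordinate selects the block whose Hamming-type syndrome is the colour; the other block can then
  be changed freely without leaving the class. This gives q trees of height \<open>n + O(1)\<close>, hence even
  \<open>n / 8\<close> trees, of which only \<open>n / 12\<close> are kept.
\<close>

section \<open>Trees given by a parent function\<close>

text \<open>\<open>depth\<close> need not be a distance in an ambient graph. That it drops by one at
  each parent forces iterated parents to end at \<open>rt\<close> and bounds the length of the walk
  there.\<close>

locale parent_function =
  fixes V :: "'a set" and rt :: 'a and par :: "'a \<Rightarrow> 'a" and depth :: "'a \<Rightarrow> nat"
  assumes finite_verts: "finite V"
    and rt_in: "rt \<in> V"
    and par_in: "\<And>v. v \<in> V \<Longrightarrow> v \<noteq> rt \<Longrightarrow> par v \<in> V"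
    and depth_par: "\<And>v. v \<in> V \<Longrightarrow> v \<noteq> rt \<Longrightarrow> depth v = Suc (depth (par v))"
begin

definition tree_of :: "'a pair_pre_digraph" where
  "tree_of = \<lparr> pverts = V,
     parcs = {(x, y). (x \<in> V \<and> x \<noteq> rt \<and> y = par x) \<or> (y \<in> V \<and> y \<noteq> rt \<and> x = par y)} \<rparr>"

lemma pverts_tree_of [simp]: "pverts tree_of = V"
  by (simp add: tree_of_def)

lemma parcs_tree_of:
  "(x, y) \<in> parcs tree_of \<longleftrightarrow>
     (x \<in> V \<and> x \<noteq> rt \<and> y = par x) \<or> (y \<in> V \<and> y \<noteq> rt \<and> x = par y)"
  by (simp add: tree_of_def)

lemma pair_graph_tree_of: "pair_graph tree_of"
proof
  show fin: "finite (pverts tree_of)" by (simp add: finite_verts)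
  have "parcs tree_of \<subseteq> V \<times> V" by (auto simp: parcs_tree_of par_in)
  then show "finite (parcs tree_of)" using finite_verts finite_subset by blast
  show "symmetric (with_proj tree_of)"
    by (auto simp: symmetric_def parcs_tree_of intro!: symI)
qed (auto simp: parcs_tree_of par_in, metis depth_par n_not_Suc_n)

sublocale T: pair_graph tree_of
  by (rule pair_graph_tree_of)

lemma walk_to_rt: "v \<in> V \<Longrightarrow> \<exists>p. T.awalk v p rt \<and> length p \<le> depth v"
proof (induction "depth v" arbitrary: v rule: less_induct)
  case less
  show ?case
  proof (cases "v = rt")
    case True
    then show ?thesis using less.prems
      by (intro exI[of _ "[]"]) (simp add: T.awalk_Nil_iff)
  next
    case False
    then obtain p where "T.awalk (par v) p rt" "length p \<le> depth (par v)"
      using less.hyps[of "par v"] less.prems par_in depth_par by auto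
    then show ?thesis using False less.prems depth_par[of v]
      by (intro exI[of _ "(v, par v) # p"]) (auto simp: T.awalk_Cons_iff parcs_tree_of)
  qed
qed

lemma walk_between:
  assumes "u \<in> V" "v \<in> V"
  shows "\<exists>p. T.awalk u p v \<and> length p \<le> depth u + depth v"
proof -
  obtain p q where p: "T.awalk u p rt" "length p \<le> depth u"
    and q: "T.awalk v q rt" "length q \<le> depth v"
    using assms walk_to_rt by blast
  have "length (rev_path q) = length q" by (induction q) auto
  then show ?thesis using p q
    by (intro exI[of _ "p @ rev_path q"]) (auto intro: T.awalk_appendI)
qed

lemma connected_tree_of: "connected (with_proj tree_of)"
proof -
  have "strongly_connected (with_proj tree_of)"
    using rt_in walk_between T.reachable_awalkI by (intro strongly_connectedI) (auto, blast)
  \<comment> \<open>\<open>connected\<close> means strong connectivity of the symmetric closure, and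
    \<open>tree_of\<close> is already symmetric.\<close>
  moreover have "mk_symmetric (with_proj tree_of) = tree_of"
    by (auto simp: mk_symmetric_def tree_of_def)
  ultimately show ?thesis by (simp add: connected_def)
qed

lemma graph_diameter_tree_of:
  assumes "\<And>v. v \<in> V \<Longrightarrow> depth v \<le> D"
  shows "graph_diameter tree_of \<le> ereal (real (2 * D))"
  unfolding graph_diameter_def
proof (intro SUP_least)
  fix u v assume "u \<in> pverts tree_of" "v \<in> pverts tree_of"
  then obtain p where p: "T.awalk u p v" "length p \<le> 2 * D"
    using walk_between[of u v] assms[of u] assms[of v] by fastforce
  have "T.awalk_cost (\<lambda>_. 1) p = real (length p)"
    by (induction p) auto
  then have "T.\<mu> (\<lambda>_. 1) u v \<le> ereal (real (length p))"
    using T.min_cost_le_walk_cost[OF p(1), of "\<lambda>_. 1"] by simp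
  also have "\<dots> \<le> ereal (real (2 * D))" using p(2) by simp
  finally show "T.\<mu> (\<lambda>_. 1) u v \<le> ereal (real (2 * D))" .
qed

text \<open>Indexed form of the chaining of arcs, so that the cycle argument can move between
  neighbouring positions.\<close>

lemma pcas_nth:
  "pcas u p v \<Longrightarrow> Suc i < length p \<Longrightarrow> snd (p ! i) = fst (p ! Suc i)"
  "pcas u p v \<Longrightarrow> p \<noteq> [] \<Longrightarrow> fst (p ! 0) = u \<and> snd (p ! (length p - 1)) = v"
proof (induction u p v arbitrary: i rule: pcas.induct)
  case (2 u e es v)
  {
    case 1
    with 2 show ?case by (cases i) (cases es; auto)+
  next
    case 2
    with "2.IH" show ?case by (cases es) auto
  }
qed auto

text \<open>Both neighbours of a deepest vertex of a cycle would have to be its parent.\<close>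

lemma no_cycle_tree_of:
  assumes "T.cycle p" "3 \<le> length p"
  shows False
proof -
  define L where "L = length p"
  have L: "3 \<le> L" using assms(2) by (simp add: L_def)
  obtain u where u: "T.awalk u p u" "distinct (tl (pawalk_verts u p))"
    using assms(1) by (auto simp: T.cycle_def)
  have cas: "pcas u p u" and arcs: "set p \<subseteq> parcs tree_of"
    using u(1) by (auto simp: T.awalk_def)
  have "tl (pawalk_verts u p) = map snd p"
    using T.awalk_verts_conv'[OF cas] L by (auto simp: L_def)
  with u(2) have dist: "distinct (map snd p)" by simp
  have cyc: "snd (p ! i) = fst (p ! (Suc i mod L))" if "i < L" for i
  proof (cases "Suc i = L")
    case True
    then have "i = length p - 1" "p \<noteq> []" using L by (auto simp: L_def)
    moreover have "Suc i mod L = 0" using True by simp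
    ultimately show ?thesis using pcas_nth(2)[OF cas] by simp
  next
    case False
    then show ?thesis using that pcas_nth(1)[OF cas, of i] by (simp add: L_def)
  qed
  define m where "m = Max ((\<lambda>i. depth (snd (p ! i))) ` {..<L})"
  have ne: "{..<L} \<noteq> {}" using L by (simp add: lessThan_empty_iff)
  have le_m: "depth (snd (p ! i)) \<le> m" if "i < L" for i
    unfolding m_def using that by (intro Max_ge) auto
  have "m \<in> (\<lambda>i. depth (snd (p ! i))) ` {..<L}"
    unfolding m_def using ne by (intro Max_in) auto
  then obtain i where i: "i < L" "depth (snd (p ! i)) = m" by auto
  \<comment> \<open>\<open>h\<close> and \<open>j\<close> are the cyclic predecessor and successor
    of the position \<open>i\<close> of a deepest vertex. They differ because the cycle has at least
    three arcs.\<close>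
  define h where "h = (if i = 0 then L - 1 else i - 1)"
  define j where "j = Suc i mod L"
  have h: "h < L" "Suc h mod L = i" using i L by (auto simp: h_def)
  have j: "j < L" using L by (auto simp: j_def)
  have "h \<noteq> j"
  proof (cases "Suc i = L")
    case True then show ?thesis using L by (auto simp: h_def j_def)
  next
    case False then show ?thesis using L i by (auto simp: h_def j_def)
  qed
  define w where "w = snd (p ! i)"
  have w1: "fst (p ! i) = snd (p ! h)" using cyc[OF h(1)] h(2) by simp
  have w2: "fst (p ! j) = w" using cyc[OF i(1)] by (simp add: j_def w_def)
  \<comment> \<open>If \<open>w\<close> were the parent of the other end of this arc, that end would
    be deeper than the maximum \<open>m\<close>.\<close>
  have "(snd (p ! h), w) \<in> parcs tree_of"
    using arcs nth_mem[of i p] i(1) w1 unfolding L_def w_def by (metis prod.collapse subsetD)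
  then have "snd (p ! h) = par w"
    using le_m[OF h(1)] i(2) depth_par by (fastforce simp: parcs_tree_of w_def)
  moreover have "(w, snd (p ! j)) \<in> parcs tree_of"
    using arcs nth_mem[of j p] j w2 unfolding L_def by (metis prod.collapse subsetD)
  then have "snd (p ! j) = par w"
    using le_m[OF j] i(2) depth_par by (fastforce simp: parcs_tree_of w_def)
  ultimately have "map snd p ! h = map snd p ! j" using h j by (simp add: L_def)
  with dist \<open>h \<noteq> j\<close> h(1) j show False by (auto simp: distinct_conv_nth L_def)
qed

lemma undirected_tree_tree_of: "undirected_tree tree_of"
  using pair_graph_tree_of connected_tree_of no_cycle_tree_of
  by (auto simp: undirected_tree_def)

text \<open>An interior vertex of a path has two distinct neighbours on it. At most one of them is
  its parent, so it is itself the parent of the other and lies in \<open>U\<close>.\<close>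

lemma inner_verts_subset:
  assumes "\<And>v. v \<in> V \<Longrightarrow> v \<noteq> rt \<Longrightarrow> par v \<in> U" and p: "T.apath u p v"
  shows "set (pawalk_verts u p) \<subseteq> {u, v} \<union> U"
proof
  fix y assume y: "y \<in> set (pawalk_verts u p)"
  have walk: "T.awalk u p v" using p by (simp add: T.apath_def)
  show "y \<in> {u, v} \<union> U"
  proof (rule ccontr)
    assume contra: "y \<notin> {u, v} \<union> U"
    then have "p \<noteq> []" using y by auto
    then have "y \<in> insert u (snd ` set p)"
      using y walk T.awalk_verts_conv'[of u p v] by (auto simp: T.awalk_def split: if_splits)
         (metis contra UnCI insertI1 list.set_sel(1) pcas_nth(2) hd_conv_nth)
    then obtain x where xy: "(x, y) \<in> set p" using contra by auto
    obtain p1 z p2 where "p = p1 @ (x, y) # (y, z) # p2" "x \<noteq> z"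
      using T.apath_succ_decomp[OF p xy] contra by auto
    then have "(x, y) \<in> parcs tree_of" "(y, z) \<in> parcs tree_of" "x \<noteq> z"
      using walk by (auto simp: T.awalk_def)
    then show False using assms(1) contra by (auto simp: parcs_tree_of)
  qed
qed

lemma undirected_spanning_tree_tree_of:
  assumes "pair_graph G" "pverts G = V"
    and "\<And>v. v \<in> V \<Longrightarrow> v \<noteq> rt \<Longrightarrow> (v, par v) \<in> parcs G"
  shows "undirected_spanning_tree tree_of G"
proof -
  interpret G: pair_graph G by fact
  have "parcs tree_of \<subseteq> parcs G"
    using assms(3) G.arcs_symmetric by (auto simp: parcs_tree_of)
  then show ?thesis
    using assms(2) undirected_tree_tree_of
    by (auto simp: undirected_spanning_tree_def spanning_def subgraph_def
        intro: G.wf_digraph T.wf_digraph[unfolded assms(2)[symmetric]])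
qed

end

section \<open>Trees from a vertex colouring\<close>

text \<open>\<open>d\<close> is the distance from \<open>rt\<close> along \<open>R\<close>, and the
  parent is the last vertex before \<open>v\<close> on some shortest walk.\<close>

lemma breadth_first_parents:
  obtains par :: "'a \<Rightarrow> 'a" and d :: "'a \<Rightarrow> nat"
  where "\<And>v D. \<exists>k\<le>D. (rt, v) \<in> R ^^ k \<Longrightarrow> d v \<le> D"
    and "\<And>v k. (rt, v) \<in> R ^^ k \<Longrightarrow> v \<noteq> rt \<Longrightarrow> (par v, v) \<in> R \<and> d v = Suc (d (par v))"
proof -
  define d where "d v = (LEAST k. (rt, v) \<in> R ^^ k)" for v
  have d: "(rt, v) \<in> R ^^ d v" "d v \<le> k" if "(rt, v) \<in> R ^^ k" for v k
    using that unfolding d_def by (auto intro: LeastI Least_le)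
  have "\<exists>u. (u, v) \<in> R \<and> d v = Suc (d u)" if v: "(rt, v) \<in> R ^^ k" "v \<noteq> rt" for v k
  proof -
    obtain l where l: "d v = Suc l" using d(1)[OF v(1)] v(2) by (cases "d v") auto
    obtain u where u: "(rt, u) \<in> R ^^ l" "(u, v) \<in> R" using d(1)[OF v(1)] l by auto
    \<comment> \<open>If \<open>d u\<close> were smaller than \<open>l\<close>, then
      \<open>v\<close> would be reached in fewer than \<open>d v\<close> steps.\<close>
    have "(rt, v) \<in> R ^^ Suc (d u)" using u d(1) by auto
    then have "d v \<le> Suc (d u)" by (rule d(2))
    then show ?thesis using d(2)[OF u(1)] u l by auto
  qed
  then have "(SOME u. (u, v) \<in> R \<and> d v = Suc (d u), v) \<in> R \<and>
      d v = Suc (d (SOME u. (u, v) \<in> R \<and> d v = Suc (d u)))"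
    if "(rt, v) \<in> R ^^ k" "v \<noteq> rt" for v k
    using that someI_ex[of "\<lambda>u. (u, v) \<in> R \<and> d v = Suc (d u)"] by blast
  moreover have "d v \<le> D" if "\<exists>k\<le>D. (rt, v) \<in> R ^^ k" for v D
    using that d(2) le_trans by blast
  ultimately show ?thesis
    using that[of d "\<lambda>v. SOME u. (u, v) \<in> R \<and> d v = Suc (d u)"] by blast
qed

text \<open>
  A vertex v outside class j is a leaf of tree j, attached along the edge to \<open>att j v\<close>; hence the
  inner vertices of tree j all lie in class j.
\<close>

lemma completely_independent_trees_from_colouring:
  fixes G :: "'a pair_pre_digraph" and c :: "'a \<Rightarrow> 'b" and att :: "'b \<Rightarrow> 'a \<Rightarrow> 'a"
  assumes G: "pair_graph G"
    and rt: "\<And>j. j \<in> J \<Longrightarrow> rt j \<in> pverts G \<and> c (rt j) = j"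
    and reach: "\<And>j v. j \<in> J \<Longrightarrow> v \<in> pverts G \<Longrightarrow> c v = j \<Longrightarrow>
      \<exists>k\<le>D. (rt j, v) \<in> {(x, y) \<in> parcs G. c x = j \<and> c y = j} ^^ k"
    and att: "\<And>j v. j \<in> J \<Longrightarrow> v \<in> pverts G \<Longrightarrow> c v \<noteq> j \<Longrightarrow>
      (v, att j v) \<in> parcs G \<and> c (att j v) = j"
    and att_att: "\<And>i j v. i \<in> J \<Longrightarrow> j \<in> J \<Longrightarrow> v \<in> pverts G \<Longrightarrow> c v = i \<Longrightarrow> i \<noteq> j \<Longrightarrow>
      att i (att j v) \<noteq> v"
  shows "\<exists>T. inj_on T J \<and>
    (\<forall>j\<in>J. undirected_spanning_tree (T j) G \<and> graph_diameter (T j) \<le> ereal (real (2 * Suc D))) \<and>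
    pairwise completely_independent (T ` J)"
proof -
  interpret G: pair_graph G by fact
  define R where "R j = {(x, y) \<in> parcs G. c x = j \<and> c y = j}" for j
  have "\<exists>par d. (\<forall>v\<in>pverts G. c v = j \<longrightarrow> d v \<le> D \<and>
      (v \<noteq> rt j \<longrightarrow> (par v, v) \<in> R j \<and> d v = Suc (d (par v))))" if "j \<in> J" for j
  proof -
    obtain par d where pd:
      "\<And>v D. \<exists>k\<le>D. (rt j, v) \<in> R j ^^ k \<Longrightarrow> d v \<le> D"
      "\<And>v k. (rt j, v) \<in> R j ^^ k \<Longrightarrow> v \<noteq> rt j \<Longrightarrow>
         (par v, v) \<in> R j \<and> d v = Suc (d (par v))"
      by (rule breadth_first_parents[of "rt j" "R j"]) (assumption | blast)+
    have "d v \<le> D \<and> (v \<noteq> rt j \<longrightarrow> (par v, v) \<in> R j \<and> d v = Suc (d (par v)))"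
      if v: "v \<in> pverts G" "c v = j" for v
    proof -
      have ex: "\<exists>k\<le>D. (rt j, v) \<in> R j ^^ k"
        unfolding R_def using \<open>j \<in> J\<close> v by (rule reach)
      then obtain k where "(rt j, v) \<in> R j ^^ k" by blast
      then show ?thesis using pd(1)[OF ex] pd(2) by blast
    qed
    then show ?thesis by blast
  qed
  then have "\<forall>j. \<exists>par d. j \<in> J \<longrightarrow> (\<forall>v\<in>pverts G. c v = j \<longrightarrow> d v \<le> D \<and>
      (v \<noteq> rt j \<longrightarrow> (par v, v) \<in> R j \<and> d v = Suc (d (par v))))"
    by blast
  from choice[OF this] obtain par where "\<forall>j. \<exists>d. j \<in> J \<longrightarrow>
      (\<forall>v\<in>pverts G. c v = j \<longrightarrow> d v \<le> D \<and>
      (v \<noteq> rt j \<longrightarrow> (par j v, v) \<in> R j \<and> d v = Suc (d (par j v))))" ..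
  from choice[OF this] obtain d where par: "\<And>j v. j \<in> J \<Longrightarrow> v \<in> pverts G \<Longrightarrow> c v = j \<Longrightarrow> d j v \<le> D"
    "\<And>j v. j \<in> J \<Longrightarrow> v \<in> pverts G \<Longrightarrow> c v = j \<Longrightarrow> v \<noteq> rt j \<Longrightarrow>
       (par j v, v) \<in> R j \<and> d j v = Suc (d j (par j v))"
    by blast
  define par' where "par' j v = (if c v = j then par j v else att j v)" for j v
  define d' where "d' j v = (if c v = j then d j v else Suc (d j (att j v)))" for j v
  have par': "(v, par' j v) \<in> parcs G" "c (par' j v) = j" "par' j v \<in> pverts G"
      "d' j v = Suc (d' j (par' j v))"
    if "j \<in> J" "v \<in> pverts G" "v \<noteq> rt j" for j v
    using that par(2)[of j v] att[of j v] G.in_arcsD2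
    by (auto simp: par'_def d'_def R_def intro: G.arcs_symmetric G.in_arcsD1)
  \<comment> \<open>The attached leaves add one level below the class.\<close>
  have d': "d' j v \<le> Suc D" if "j \<in> J" "v \<in> pverts G" for j v
    using that par(1)[of j v] par(1)[of j "att j v"] att[of j v] G.in_arcsD2
    by (auto simp: d'_def)
  have loc: "parent_function (pverts G) (rt j) (par' j) (d' j)" if "j \<in> J" for j
    using that rt par' G.pair_finite_verts by unfold_locales auto
  define T where "T j = parent_function.tree_of (pverts G) (rt j) (par' j)" for j
  have span: "undirected_spanning_tree (T j) G" and diam: "graph_diameter (T j) \<le> ereal (real (2 * Suc D))"
    if "j \<in> J" for j
  proof -
    interpret P: parent_function "pverts G" "rt j" "par' j" "d' j" using loc that .
    show "undirected_spanning_tree (T j) G"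
      unfolding T_def using that par' by (intro P.undirected_spanning_tree_tree_of G) auto
    show "graph_diameter (T j) \<le> ereal (real (2 * Suc D))"
      unfolding T_def using that d' by (intro P.graph_diameter_tree_of) auto
  qed
  have arcs: "(x, y) \<in> parcs (T j) \<longleftrightarrow> (x \<in> pverts G \<and> x \<noteq> rt j \<and> y = par' j x) \<or>
      (y \<in> pverts G \<and> y \<noteq> rt j \<and> x = par' j y)" if "j \<in> J" for j x y
    unfolding T_def using parent_function.parcs_tree_of[OF loc[OF that]] .
  have arcs_disj: "parcs (T i) \<inter> parcs (T j) = {}" if ij: "i \<in> J" "j \<in> J" "i \<noteq> j" for i j
  proof -
    \<comment> \<open>Parents in tree \<open>k\<close> have colour \<open>k\<close>, so two trees
      cannot use an edge in the same direction. In opposite directions both ends would be attached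
      leaves, which \<open>att_att\<close> forbids.\<close>
    have opposite: False if "x \<in> pverts G" "x \<noteq> rt k" "y \<in> pverts G" "y \<noteq> rt l"
      "y = par' k x" "x = par' l y" "k \<in> J" "l \<in> J" "k \<noteq> l" for x y k l
    proof -
      have col: "c y = k" "c x = l" using par'(2) that by metis+
      then have "par' k x = att k x" "par' l y = att l y"
        using \<open>k \<noteq> l\<close> by (simp_all add: par'_def)
      then have "att l (att k x) = x" using that(5,6) by metis
      then show False using att_att[of l k x] that(1,7-9) col by simp
    qed
    have "False" if "(x, y) \<in> parcs (T i)" "(x, y) \<in> parcs (T j)" for x y
      using that unfolding arcs[OF ij(1)] arcs[OF ij(2)]
      using opposite[of x i y j] opposite[of y i x j] par'(2)[of i] par'(2)[of j] ij by metis
    then show ?thesis by auto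
  qed
  have indep: "completely_independent (T i) (T j)" if ij: "i \<in> J" "j \<in> J" "i \<noteq> j" for i j
    unfolding completely_independent_def
  proof (intro conjI arcs_disj[OF ij] allI impI)
    fix u v p q
    assume "pre_digraph.apath (with_proj (T i)) u p v" "pre_digraph.apath (with_proj (T j)) u q v"
    then have "set (pawalk_verts u p) \<subseteq> {u, v} \<union> {x. c x = i}"
      "set (pawalk_verts u q) \<subseteq> {u, v} \<union> {x. c x = j}"
      unfolding T_def using ij par'(2)
      by (intro parent_function.inner_verts_subset[OF loc[OF ij(1)]]
          parent_function.inner_verts_subset[OF loc[OF ij(2)]]; simp)+
    then show "set (pawalk_verts u p) \<inter> set (pawalk_verts u q) \<subseteq> {u, v}" using ij(3) by blast
  qed
  \<comment> \<open>Disjoint arc sets are equal only if empty, but the root of tree \<open>j\<close>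
    is a leaf of tree \<open>i\<close>.\<close>
  have "T i \<noteq> T j" if ij: "i \<in> J" "j \<in> J" "i \<noteq> j" for i j
  proof -
    have "(rt j, par' i (rt j)) \<in> parcs (T i)"
      using rt[OF ij(1)] rt[OF ij(2)] ij by (auto simp: arcs)
    then show ?thesis using arcs_disj[OF ij] by auto
  qed
  then have "inj_on T J" by (auto simp: inj_on_def)
  moreover have "pairwise completely_independent (T ` J)"
    using indep by (auto simp: pairwise_def)
  ultimately show ?thesis using span diam by blast
qed

section \<open>The colouring of the hypercube\<close>

lemma pair_graph_hypercube: "pair_graph (hypercube n)"
proof
  show fin: "finite (pverts (hypercube n))"
    using finite_lists_length_eq[of "UNIV :: bool set" n] by (simp add: hypercube_def)
  have "parcs (hypercube n) \<subseteq> pverts (hypercube n) \<times> pverts (hypercube n)"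
    by (auto simp: hypercube_def)
  then show "finite (parcs (hypercube n))" using fin finite_subset by blast
  show "symmetric (with_proj (hypercube n))"
    by (auto simp: symmetric_def hypercube_def intro!: symI)
  show "fst e \<noteq> snd e" if "e \<in> parcs (hypercube n)" for e
  proof -
    have "\<exists>!i. i < n \<and> fst e ! i \<noteq> snd e ! i"
      using that by (simp add: hypercube_def case_prod_beta)
    then show ?thesis using ex1_implies_ex by fastforce
  qed
qed (simp_all add: hypercube_def case_prod_beta)

section \<open>Bit flips, syndromes and colours\<close>

definition flip :: "nat \<Rightarrow> bool list \<Rightarrow> bool list" where
  "flip i x = x[i := \<not> x ! i]"

lemma length_flip [simp]: "length (flip i x) = length x"
  by (simp add: flip_def)

lemma nth_flip: "i < length x \<Longrightarrow> flip i x ! k = (if k = i then \<not> x ! i else x ! k)"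
  by (auto simp: flip_def nth_list_update)

lemma flip_arc: "length x = n \<Longrightarrow> i < n \<Longrightarrow> (x, flip i x) \<in> parcs (hypercube n)"
  by (auto simp: hypercube_def nth_flip)

text \<open>
  Coordinate 0 is the switch bit b; it has weight 0 in both blocks. The two blocks are
  \<open>{..<2 * q}\<close> and \<open>{2 * q..<4 * q}\<close>, and each nonzero colour is the weight of two coordinates of
  each block.
\<close>

definition weight :: "nat \<Rightarrow> bool \<Rightarrow> nat \<Rightarrow> nat" where
  "weight q b i = (if (if b then 2 * q \<le> i \<and> i < 4 * q else i < 2 * q) then i mod q else 0)"

text \<open>The parity-check product of \<open>x\<close> with the columns
  \<open>weight q b i\<close>, each column being read as a number in binary.\<close>

definition syndrome :: "nat \<Rightarrow> bool \<Rightarrow> bool list \<Rightarrow> nat" where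
  "syndrome q b x =
     foldr (\<lambda>i a. if x ! i then Bit_Operations.xor (weight q b i) a else a) [0..<length x] 0"

definition colour :: "nat \<Rightarrow> bool list \<Rightarrow> nat" where
  "colour q x = syndrome q (x ! 0) x"

lemma syndrome_flip:
  assumes "i < length x"
  shows "syndrome q b (flip i x) = Bit_Operations.xor (weight q b i) (syndrome q b x)"
proof -
  \<comment> \<open>Generalised to any list of distinct indices for the induction; distinctness
    ensures that the weight of \<open>i\<close> is toggled only once.\<close>
  have "foldr (\<lambda>k a. if flip i x ! k then Bit_Operations.xor (w k) a else a) ks 0 =
     (if i \<in> set ks then Bit_Operations.xor (w i) else id)
       (foldr (\<lambda>k a. if x ! k then Bit_Operations.xor (w k) a else a) ks 0)"
    if "distinct ks" for ks and w :: "nat \<Rightarrow> nat"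
    using that
    by (induction ks) (auto simp: nth_flip[OF assms] xor.left_commute xor.assoc[symmetric])
  from this[of "[0..<length x]" "weight q b"] show ?thesis
    using assms by (simp add: syndrome_def)
qed

lemma xor_less:
  fixes a b :: nat
  shows "a < 2 ^ r \<Longrightarrow> b < 2 ^ r \<Longrightarrow> Bit_Operations.xor a b < 2 ^ r"
  by (metis take_bit_nat_eq_self_iff take_bit_xor)

lemma xor_cancel:
  fixes a b :: nat
  shows "Bit_Operations.xor a (Bit_Operations.xor a b) = b"
  by (simp flip: xor.assoc)

lemma syndrome_less: "syndrome (2 ^ r) b x < 2 ^ r"
proof -
  have "foldr (\<lambda>i a. if x ! i then Bit_Operations.xor (weight (2 ^ r) b i) a else a) ks 0 < 2 ^ r" for ks
    by (induction ks) (auto intro!: xor_less simp: weight_def)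
  then show ?thesis by (simp add: syndrome_def)
qed

definition base :: "nat \<Rightarrow> bool \<Rightarrow> nat" where
  "base q b = (if b then 2 * q else 0)"

lemma weight_base:
  assumes "a < q"
  shows "weight q b (base q b + a) = a" "weight q b (base q b + q + a) = a"
    "weight q (\<not> b) (base q b + a) = 0" "weight q (\<not> b) (base q b + q + a) = 0"
  using assms by (auto simp: weight_def base_def mod_simps)

lemma weight_0 [simp]: "weight q b 0 = 0"
  by (simp add: weight_def)

text \<open>
  In the plane of the two coordinates of weight \<open>a\<close>, the vertices form a 4-cycle whose colours
  alternate between two values; \<open>attach\<close> orients this cycle, so no edge is used in both directions.
\<close>

definition attach :: "nat \<Rightarrow> nat \<Rightarrow> bool list \<Rightarrow> bool list" where
  "attach q j v = (let k = base q (v ! 0) + Bit_Operations.xor (colour q v) j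
     in flip (if v ! k = v ! (k + q) then k else k + q) v)"

context
  fixes r q n :: nat
  assumes q: "q = 2 ^ r" and n: "4 * q \<le> n"
begin

lemma q_pos: "0 < q"
  by (simp add: q)

lemma base_bound: "a < q \<Longrightarrow> base q b + q + a < n"
  using n by (auto simp: base_def)

lemma colour_less: "colour q v < q"
  by (simp add: colour_def q syndrome_less)

lemma colour_flip:
  "length v = n \<Longrightarrow> 0 < i \<Longrightarrow> i < n \<Longrightarrow>
    colour q (flip i v) = Bit_Operations.xor (weight q (v ! 0) i) (colour q v)"
  by (simp add: colour_def nth_flip syndrome_flip)

lemma attach:
  assumes v: "length v = n" and j: "j < q" "colour q v \<noteq> j"
  shows "(v, attach q j v) \<in> parcs (hypercube n)" "colour q (attach q j v) = j"
    "attach q (colour q v) (attach q j v) \<noteq> v"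
proof -
  define b where "b = v ! 0"
  define i where "i = colour q v"
  define a where "a = Bit_Operations.xor i j"
  define k where "k = base q b + a"
  have a: "a < q" using j(1) colour_less[of v] by (simp add: a_def i_def q xor_less)
  \<comment> \<open>This keeps \<open>k\<close> off coordinate 0, so the attaching flip leaves the
    switch bit alone.\<close>
  have "a \<noteq> 0"
  proof
    assume "a = 0"
    then have "Bit_Operations.xor (Bit_Operations.xor i j) j = j" by (simp add: a_def)
    then show False using j(2) by (simp add: xor.assoc i_def)
  qed
  then have k: "0 < k" "k + q < n" "k < n" using base_bound[OF a, of b] by (auto simp: k_def)
  have kq: "k + q = base q b + q + a" by (simp add: k_def)
  have w: "weight q b k = a" "weight q b (k + q) = a"
    unfolding kq unfolding k_def using weight_base[OF a] by auto
  define m where "m = (if v ! k = v ! (k + q) then k else k + q)"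
  have att: "attach q j v = flip m v"
    by (simp add: attach_def Let_def b_def[symmetric] i_def[symmetric] a_def[symmetric]
        k_def[symmetric] m_def)
  have m: "0 < m" "m < n" "weight q b m = a" using k w by (auto simp: m_def)
  show "(v, attach q j v) \<in> parcs (hypercube n)" unfolding att using v m by (intro flip_arc)
  have "colour q (attach q j v) = Bit_Operations.xor a i"
    unfolding att using colour_flip[OF v m(1,2)] m(3) by (simp add: b_def i_def)
  then show col: "colour q (attach q j v) = j" by (simp add: a_def xor.commute[of _ i] xor_cancel)
  \<comment> \<open>One flip changes whether the bits at \<open>k\<close> and \<open>k + q\<close>
    agree, so the way back flips the other coordinate.\<close>
  define m' where "m' = (if flip m v ! k = flip m v ! (k + q) then k else k + q)"
  have "flip m v ! 0 = b" using v m n by (simp add: nth_flip b_def)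
  moreover have "Bit_Operations.xor (colour q (flip m v)) i = a"
    using col by (simp add: att a_def xor.commute)
  ultimately have "attach q i (flip m v) = flip m' (flip m v)"
    by (simp only: attach_def Let_def k_def[symmetric] m'_def)
  moreover have "m' \<noteq> m" "m' < n" using k m v q_pos by (auto simp: m'_def m_def nth_flip)
  ultimately have "attach q i (flip m v) ! m \<noteq> v ! m" using m v by (simp add: nth_flip)
  then show "attach q (colour q v) (attach q j v) \<noteq> v" by (auto simp: att i_def)
qed

section \<open>Radius of the colour classes\<close>

definition step :: "nat \<Rightarrow> (bool list \<times> bool list) set" where
  "step j = {(x, y) \<in> parcs (hypercube n). colour q x = j \<and> colour q y = j}"

definition reaches :: "nat \<Rightarrow> nat \<Rightarrow> bool list \<Rightarrow> bool list \<Rightarrow> bool" where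
  "reaches j D x y \<longleftrightarrow> (\<exists>k\<le>D. (x, y) \<in> step j ^^ k)"

lemma reaches_trans: "reaches j D x y \<Longrightarrow> reaches j E y z \<Longrightarrow> reaches j (D + E) x z"
  unfolding reaches_def relpow_add[symmetric]
  by (elim exE conjE, rule_tac x = "k + ka" in exI) (auto simp: relpow_add)

lemma reaches_mono: "reaches j D x y \<Longrightarrow> D \<le> E \<Longrightarrow> reaches j E x y"
  unfolding reaches_def using le_trans by blast

lemma reaches_flip:
  "length x = n \<Longrightarrow> i < n \<Longrightarrow> colour q x = j \<Longrightarrow> colour q (flip i x) = j \<Longrightarrow> reaches j 1 x (flip i x)"
  unfolding reaches_def by (intro exI[of _ 1]) (simp add: step_def flip_arc)

text \<open>While the switch bit is \<open>b\<close>, flipping a coordinate of weight 0 for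
  \<open>b\<close> preserves the colour, so differing coordinates are corrected one by one.\<close>

lemma reaches_free_coordinates:
  assumes "finite F" "F \<subseteq> {1..<n}" "\<And>i. i \<in> F \<Longrightarrow> weight q b i = 0"
    "length x = n" "length y = n" "x ! 0 = b" "syndrome q b x = j"
    "\<And>i. i < n \<Longrightarrow> i \<notin> F \<Longrightarrow> x ! i = y ! i"
  shows "reaches j (card F) x y"
  using assms
proof (induction F arbitrary: x rule: finite_induct)
  case empty
  then have "x = y" by (intro nth_equalityI) auto
  then show ?case by (auto simp: reaches_def)
next
  case (insert i F)
  have i: "0 < i" "i < n" "weight q b i = 0" using insert.prems by auto
  show ?case
  proof (cases "x ! i = y ! i")
    case True
    have "reaches j (card F) x y"
      using insert.prems True by (intro insert.IH) auto
    then show ?thesis using insert.hyps by (auto intro: reaches_mono)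
  next
    case False
    have "reaches j (card F) (flip i x) y"
      using insert.prems False i
      by (intro insert.IH) (auto simp: nth_flip syndrome_flip)
    moreover have "reaches j 1 x (flip i x)"
      using insert.prems i by (intro reaches_flip) (auto simp: colour_flip, auto simp: colour_def)
    ultimately have "reaches j (1 + card F) x y" by (intro reaches_trans)
    then show ?thesis using insert.hyps by simp
  qed
qed

text \<open>One true bit of weight \<open>j\<close> in each block makes both syndromes equal to
  \<open>j\<close>. The summand \<open>q\<close> avoids the switch bit when
  \<open>j = 0\<close>.\<close>

definition origin :: "nat \<Rightarrow> bool list" where
  "origin j = flip (base q True + q + j) (flip (base q False + q + j) (replicate n False))"

lemma origin:
  assumes "j < q"
  shows "length (origin j) = n" "origin j ! 0 = False" "syndrome q b (origin j) = j"
proof -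
  have bd: "base q b + q + j < n" for b using assms by (rule base_bound)
  have "syndrome q b (replicate n False) = 0"
  proof -
    have "foldr (\<lambda>i a. if replicate n False ! i then Bit_Operations.xor (weight q b i) a else a) ks 0 = 0"
      if "set ks \<subseteq> {..<n}" for ks
      using that by (induction ks) auto
    then show ?thesis unfolding syndrome_def by force
  qed
  then show "syndrome q b (origin j) = j"
    using weight_base[OF assms, of False] weight_base[OF assms, of True] bd[of True] bd[of False]
    by (cases b) (auto simp: origin_def syndrome_flip)
  show "length (origin j) = n" by (simp add: origin_def)
  show "origin j ! 0 = False"
    using bd[of True] bd[of False] q_pos by (auto simp: origin_def nth_flip)
qed

lemma syndrome_cong:
  assumes "length x = n" "length y = n" "\<And>i. i < n \<Longrightarrow> weight q b i \<noteq> 0 \<Longrightarrow> x ! i = y ! i"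
  shows "syndrome q b x = syndrome q b y"
proof -
  have "(if x ! i then Bit_Operations.xor (weight q b i) a else a) =
      (if y ! i then Bit_Operations.xor (weight q b i) a else a)" if "i < n" for i a
    using that assms(3) by (cases "weight q b i = 0") auto
  then show ?thesis unfolding syndrome_def using assms(1,2) by (intro foldr_cong) auto
qed

text \<open>
  With switch bit 0 the second block moves freely, with switch bit 1 the first; the switch can
  be flipped where both syndromes agree.
\<close>

lemma reaches_origin_both:
  assumes j: "j < q" and v: "length v = n" "\<And>b. syndrome q b v = j"
  shows "reaches j (n + 2) (origin j) v"
proof -
  note o = origin[OF j]
  \<comment> \<open>\<open>u\<close> combines the first block of the origin with the remaining
    coordinates of \<open>v\<close>, so both its syndromes are \<open>j\<close>. The route is
    \<open>origin j\<close>, \<open>u\<close>, \<open>flip 0 u\<close>, \<open>v1\<close>,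
    \<open>v\<close>.\<close>
  define u where "u = map (\<lambda>i. if i = 0 then False else if i < 2 * q then origin j ! i else v ! i) [0..<n]"
  define v0 where "v0 = v[0 := False]"
  define v1 where "v1 = v[0 := True]"
  have n0: "0 < n" using n q_pos by auto
  have u: "length u = n" by (simp add: u_def)
  have nth_u: "u ! i = (if i = 0 then False else if i < 2 * q then origin j ! i else v ! i)" if "i < n" for i
    using that by (simp add: u_def)
  have "syndrome q False u = syndrome q False (origin j)"
    using u o by (intro syndrome_cong) (auto simp: nth_u weight_def split: if_splits)
  moreover have "syndrome q True u = syndrome q True v"
    using u v by (intro syndrome_cong) (auto simp: nth_u weight_def split: if_splits)
  ultimately have syn_u: "syndrome q b u = j" for b using o v by (cases b) auto
  have both: "syndrome q b (flip 0 x) = syndrome q b x" if "length x = n" for b x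
    using that n0 by (simp add: syndrome_flip)
  have switch: "reaches j 1 x (flip 0 x)" if "length x = n" "\<And>b. syndrome q b x = j" for x
    using that n0 by (intro reaches_flip) (auto simp: colour_def both)
  have "reaches j (card {2 * q..<n}) (origin j) u"
    using o u q_pos by (intro reaches_free_coordinates[where b = False])
      (auto simp: nth_u weight_def)
  moreover have "reaches j 1 u (flip 0 u)" using u syn_u by (rule switch)
  moreover have "reaches j (card {1..<2 * q}) (flip 0 u) v1"
    using o u v n n0 by (intro reaches_free_coordinates[where b = True])
      (auto simp: nth_u nth_flip weight_def v1_def nth_list_update both syn_u)
  ultimately have v1: "reaches j (card {2 * q..<n} + 1 + card {1..<2 * q}) (origin j) v1"
    by (meson reaches_trans)
  have bound: "card {2 * q..<n} + 1 + card {1..<2 * q} + 1 \<le> n + 2" using n q_pos by simp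
  show ?thesis
  proof (cases "v ! 0")
    case True
    then have "v1 = v" by (simp add: v1_def list_update_same_conv n0 v(1))
    then show ?thesis using v1 bound by (auto intro: reaches_mono)
  next
    case False
    then have eq: "flip 0 v = v1" "flip 0 v1 = v"
      using n0 v(1) by (auto simp: v1_def flip_def) (metis list_update_id)
    have "reaches j 1 v1 v"
      using switch[of v1] v both[of v] by (simp add: eq(2)) (simp add: eq(1)[symmetric])
    then show ?thesis using v1 bound reaches_trans reaches_mono by blast
  qed
qed

text \<open>Only the syndrome selected by the switch bit is known to be \<open>j\<close>. One flip
  in the other block corrects the other syndrome without changing the colour.\<close>

lemma reaches_origin:
  assumes v: "length v = n" "colour q v = j"
  shows "reaches j (n + 3) (origin j) v"
proof -
  have j: "j < q" using colour_less v(2) by blast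
  define b where "b = v ! 0"
  define a where "a = Bit_Operations.xor (syndrome q (\<not> b) v) j"
  define k where "k = base q (\<not> b) + q + a"
  have a: "a < q" using j syndrome_less[of r] by (simp add: a_def q xor_less)
  have k: "0 < k" "k < n" using base_bound[OF a] q_pos by (auto simp: k_def)
  have w: "weight q (\<not> b) k = a" "weight q b k = 0"
    unfolding k_def using weight_base[OF a, of "\<not> b"] by auto
  have j_b: "syndrome q b v = j" using v(2) by (simp add: colour_def b_def)
  have both: "syndrome q b' (flip k v) = j" for b'
  proof (cases "b' = b")
    case True
    then show ?thesis using k v w j_b by (simp add: syndrome_flip)
  next
    case False
    then have "b' = (\<not> b)" by auto
    then show ?thesis using k v w
      by (simp add: syndrome_flip) (simp add: a_def xor.assoc xor.commute[of _ j])
  qed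
  have near: "reaches j (n + 2) (origin j) (flip k v)"
    using v both by (intro reaches_origin_both j) auto
  have "colour q (flip k v) = j" by (simp add: colour_def both)
  moreover have "flip k (flip k v) = v" using k v by (simp add: flip_def)
  ultimately have "reaches j 1 (flip k v) v"
    using reaches_flip[of "flip k v" k j] k v by simp
  with near have "reaches j (n + 2 + 1) (origin j) v" by (rule reaches_trans)
  then show ?thesis by (simp add: numeral_3_eq_3)
qed

section \<open>Assembling the trees and choosing the power of two\<close>

lemma hypercube_trees:
  "\<exists>T. inj_on T {..<q} \<and>
    (\<forall>j\<in>{..<q}. undirected_spanning_tree (T j) (hypercube n) \<and>
       graph_diameter (T j) \<le> ereal (real (2 * Suc (n + 3)))) \<and>
    pairwise completely_independent (T ` {..<q})"
proof (rule completely_independent_trees_from_colouring[where c = "colour q" and rt = origin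
      and att = "attach q"])
  fix j v
  assume "j \<in> {..<q}" "v \<in> pverts (hypercube n)" "colour q v = j"
  then have "reaches j (n + 3) (origin j) v"
    using reaches_origin by (simp add: hypercube_def)
  then show "\<exists>k\<le>n + 3. (origin j, v) \<in>
      {(x, y) \<in> parcs (hypercube n). colour q x = j \<and> colour q y = j} ^^ k"
    unfolding reaches_def step_def .
next
  fix j assume "j \<in> {..<q}"
  then show "origin j \<in> pverts (hypercube n) \<and> colour q (origin j) = j"
    using origin by (simp add: hypercube_def colour_def)
next
  fix j v assume "j \<in> {..<q}" "v \<in> pverts (hypercube n)" "colour q v \<noteq> j"
  then show "(v, attach q j v) \<in> parcs (hypercube n) \<and> colour q (attach q j v) = j"
    using attach(1,2) by (simp add: hypercube_def)
next
  fix i j v assume "i \<in> {..<q}" "j \<in> {..<q}" "v \<in> pverts (hypercube n)" "colour q v = i" "i \<noteq> j"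
  then show "attach q i (attach q j v) \<noteq> v"
    using attach(3)[of v j] by (auto simp: hypercube_def)
qed (rule pair_graph_hypercube)

end

theorem theorem2:
  shows "\<exists>f g :: nat \<Rightarrow> nat.
    (\<lambda>n. real (f n) / real n) \<longlonglongrightarrow> 1 / 12 \<and>
    (\<lambda>n. real (g n) / real n) \<longlonglongrightarrow> 2 \<and>
    (\<forall>\<^sub>F n in sequentially.
       \<exists>\<T> :: bool list pair_pre_digraph set.
         finite \<T> \<and> card \<T> = f n \<and>
         (\<forall>T \<in> \<T>. undirected_spanning_tree T (hypercube n) \<and>
                  graph_diameter T \<le> ereal (real (g n))) \<and>
         pairwise completely_independent \<T>)"
proof (intro exI conjI)
  \<comment> \<open>The goals shown below fix the witnesses: \<open>f n = n div 12\<close> and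
    \<open>g n = 2 * Suc (n + 3)\<close>, twice the height bound.\<close>
  have "(\<lambda>n. real_of_int \<lfloor>real n / 12\<rfloor> / real n) \<longlonglongrightarrow> 1 / 12"
    by real_asymp
  moreover have "real_of_int \<lfloor>real n / 12\<rfloor> = real (n div 12)" for n
    using floor_divide_of_nat_eq[of n 12, where 'a = real] by simp
  ultimately show "(\<lambda>n. real (n div 12) / real n) \<longlonglongrightarrow> 1 / 12"
    by simp
  show "(\<lambda>n. real (2 * Suc (n + 3)) / real n) \<longlonglongrightarrow> 2"
    by real_asymp
  show "\<forall>\<^sub>F n in sequentially.
       \<exists>\<T> :: bool list pair_pre_digraph set.
         finite \<T> \<and> card \<T> = n div 12 \<and>
         (\<forall>T \<in> \<T>. undirected_spanning_tree T (hypercube n) \<and>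
                  graph_diameter T \<le> ereal (real (2 * Suc (n + 3)))) \<and>
         pairwise completely_independent \<T>"
    using eventually_ge_at_top[of 4]
  proof eventually_elim
    case (elim n)
    \<comment> \<open>The largest power of two up to \<open>n div 4\<close> satisfies
      \<open>n < 8 * 2 ^ r\<close>, so it provides at least \<open>n div 12\<close> trees.\<close>
    have "\<exists>r. 2 ^ r \<le> m \<and> m < 2 ^ Suc r" if "1 \<le> m" for m :: nat
      using that ex_power_ivl1[of 2 m] by auto
    then obtain r where r: "2 ^ r \<le> n div 4" "n div 4 < 2 ^ Suc r"
      using elim by (metis div_greater_zero_iff less_eq_Suc_le One_nat_def zero_less_numeral)
    have le: "4 * 2 ^ r \<le> n" and less: "n div 12 \<le> 2 ^ r" using r by auto
    obtain T :: "nat \<Rightarrow> bool list pair_pre_digraph" where T: "inj_on T {..<2 ^ r}"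
      "\<forall>j\<in>{..<2 ^ r}. undirected_spanning_tree (T j) (hypercube n) \<and>
         graph_diameter (T j) \<le> ereal (real (2 * Suc (n + 3)))"
      "pairwise completely_independent (T ` {..<2 ^ r})"
      using hypercube_trees[OF refl le] by blast
    have sub: "{..<n div 12} \<subseteq> {..<2 ^ r}" using less by auto
    show ?case
    proof (intro exI[of _ "T ` {..<n div 12}"] conjI)
      show "card (T ` {..<n div 12}) = n div 12"
        using inj_on_subset[OF T(1) sub] by (simp add: card_image)
      show "pairwise completely_independent (T ` {..<n div 12})"
        by (rule pairwise_subset[OF T(3) image_mono[OF sub]])
    qed (use T(2) sub in auto)
  qed
qed

end
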